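(* Let $G$ be a group, let $A$ be either a finitely generated abelian group or $A=\mathbb{R}$, and let $\alpha\in H^n(G,A)$, where $n\geq 1$ is an integer. Then $\alpha$ is weakly bounded if and only if $\iota^n(\alpha)=0$ in $H^n_{(\infty)}(G,A)$.
   Context: $C^*(G,A)$ denotes the inhomogeneous bar complex of $G$ with trivial coefficients $A$, so an $n$-cochain is a map $\omega\colon G^n\to A$. A subset of a finitely generated abelian group is bounded if it is finite; for $A=\mathbb{R}$ bounded has its usual meaning. A cochain $\omega\in C^n(G,A)$ is weakly bounded if for every fixed $(g_2,\dots,g_n)\in G^{n-1}$ the set $\omega(G,g_2,\dots,g_n)=\{\omega(g,g_2,\dots,g_n): g\in G\}$ is bounded. A class in $H^n(G,A)$ is weakly bounded if it is represented by a weakly bounded cocycle. $\ell^\infty(G,A)$ is the module of bounded functions $G\to A$, with the left $G$-action $(g\cdot f)(h)=f(g^{-1}h)$. The $\ell^\infty$-cohomology $H^*_{(\infty)}(G,A)$ is the cohomology of the bar complex $C^*_{(\infty)}(G,A)=C^*(G,\ell^\infty(G,A))$ with twisted coefficients. The inclusion of $A$ (trivial $G$-module) into $\ell^\infty(G,A)$ as constant functions is $G$-equivariant and induces $\iota^*\colon H^*(G,A)\to H^*_{(\infty)}(G,A)$. *)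

theory Defs
  imports "HOL-Algebra.Algebra" "HOL-Algebra.Product_Groups" "HOL-Analysis.Elementary_Metric_Spaces"
begin

text \<open>
  Abelian groups are written multiplicatively, following HOL-Algebra. A left \<open>G\<close>-module is given by
  a commutative group \<open>M\<close> together with its action map \<open>act\<close>.
\<close>

definition finitely_generated_group :: "('a, 'b) monoid_scheme \<Rightarrow> bool" where
  "finitely_generated_group A \<longleftrightarrow>
     group A \<and> (\<exists>S. finite S \<and> S \<subseteq> carrier A \<and> generate A S = carrier A)"

definition real_group :: "real monoid" where
  "real_group = \<lparr>carrier = UNIV, monoid.mult = (+), one = 0\<rparr>"


subsection \<open>The inhomogeneous bar complex\<close>

definition tuples :: "('g, 'x) monoid_scheme \<Rightarrow> nat \<Rightarrow> 'g list set" where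
  "tuples G n = {gs. set gs \<subseteq> carrier G \<and> length gs = n}"

definition cochains ::
  "('g, 'x) monoid_scheme \<Rightarrow> ('m, 'y) monoid_scheme \<Rightarrow> nat \<Rightarrow> ('g list \<Rightarrow> 'm) monoid" where
  "cochains G M n = product_group (tuples G n) (\<lambda>_. M)"

text \<open>\<open>merge G i [g\<^sub>1, \<dots>, g\<^sub>n\<^sub>+\<^sub>1] = [g\<^sub>1, \<dots>, g\<^sub>ig\<^sub>i\<^sub>+\<^sub>1, \<dots>, g\<^sub>n\<^sub>+\<^sub>1]\<close> for \<open>1 \<le> i \<le> n\<close>;
  note that \<open>gs ! (i - 1)\<close> is \<open>g\<^sub>i\<close>.\<close>

definition merge :: "('g, 'x) monoid_scheme \<Rightarrow> nat \<Rightarrow> 'g list \<Rightarrow> 'g list" where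
  "merge G i gs = take (i - 1) gs @ [gs ! (i - 1) \<otimes>\<^bsub>G\<^esub> gs ! i] @ drop (i + 1) gs"

text \<open>In additive notation, the coboundary is
  \<open>(\<delta>\<omega>)(g\<^sub>1, \<dots>, g\<^sub>n\<^sub>+\<^sub>1) = g\<^sub>1 \<cdot> \<omega>(g\<^sub>2, \<dots>, g\<^sub>n\<^sub>+\<^sub>1)
     + (\<Sum>i = 1..n. (-1)\<^sup>i \<omega>(g\<^sub>1, \<dots>, g\<^sub>ig\<^sub>i\<^sub>+\<^sub>1, \<dots>, g\<^sub>n\<^sub>+\<^sub>1)) + (-1)\<^sup>n\<^sup>+\<^sup>1 \<omega>(g\<^sub>1, \<dots>, g\<^sub>n)\<close>.\<close>

definition coboundary ::
  "('g, 'x) monoid_scheme \<Rightarrow> ('m, 'y) monoid_scheme \<Rightarrow> ('g \<Rightarrow> 'm \<Rightarrow> 'm) \<Rightarrow> nat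
    \<Rightarrow> ('g list \<Rightarrow> 'm) \<Rightarrow> ('g list \<Rightarrow> 'm)" where
  "coboundary G M act n \<omega> = (\<lambda>gs\<in>tuples G (Suc n).
     act (hd gs) (\<omega> (tl gs))
     \<otimes>\<^bsub>M\<^esub> (\<Otimes>\<^bsub>M\<^esub>i\<in>{1..n}. \<omega> (merge G i gs) [^]\<^bsub>M\<^esub> ((- 1) ^ i :: int))
     \<otimes>\<^bsub>M\<^esub> \<omega> (butlast gs) [^]\<^bsub>M\<^esub> ((- 1) ^ Suc n :: int))"

definition cocycles ::
  "('g, 'x) monoid_scheme \<Rightarrow> ('m, 'y) monoid_scheme \<Rightarrow> ('g \<Rightarrow> 'm \<Rightarrow> 'm) \<Rightarrow> nat
    \<Rightarrow> ('g list \<Rightarrow> 'm) set" where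
  "cocycles G M act n = kernel (cochains G M n) (cochains G M (Suc n)) (coboundary G M act n)"

definition coboundaries ::
  "('g, 'x) monoid_scheme \<Rightarrow> ('m, 'y) monoid_scheme \<Rightarrow> ('g \<Rightarrow> 'm \<Rightarrow> 'm) \<Rightarrow> nat
    \<Rightarrow> ('g list \<Rightarrow> 'm) set" where
  "coboundaries G M act n = (case n of
       0 \<Rightarrow> {\<one>\<^bsub>cochains G M 0\<^esub>}
     | Suc k \<Rightarrow> coboundary G M act k ` carrier (cochains G M k))"

definition cohomology ::
  "('g, 'x) monoid_scheme \<Rightarrow> ('m, 'y) monoid_scheme \<Rightarrow> ('g \<Rightarrow> 'm \<Rightarrow> 'm) \<Rightarrow> nat
    \<Rightarrow> ('g list \<Rightarrow> 'm) set monoid" where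
  "cohomology G M act n =
     (cochains G M n)\<lparr>carrier := cocycles G M act n\<rparr> Mod coboundaries G M act n"

definition cohom_class ::
  "('g, 'x) monoid_scheme \<Rightarrow> ('m, 'y) monoid_scheme \<Rightarrow> ('g \<Rightarrow> 'm \<Rightarrow> 'm) \<Rightarrow> nat
    \<Rightarrow> ('g list \<Rightarrow> 'm) \<Rightarrow> ('g list \<Rightarrow> 'm) set" where
  "cohom_class G M act n \<omega> = coboundaries G M act n #>\<^bsub>cochains G M n\<^esub> \<omega>"

text \<open>The map induced on cohomology by an equivariant homomorphism \<open>f\<close> into the module \<open>N\<close>.
  Since cohomologous cocycles have cohomologous images, all members of the union coincide.\<close>

definition coeff_map ::
  "('g, 'x) monoid_scheme \<Rightarrow> ('k, 'z) monoid_scheme \<Rightarrow> ('g \<Rightarrow> 'k \<Rightarrow> 'k) \<Rightarrow> nat \<Rightarrow> ('m \<Rightarrow> 'k)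
    \<Rightarrow> ('g list \<Rightarrow> 'm) set \<Rightarrow> ('g list \<Rightarrow> 'k) set" where
  "coeff_map G N act n f \<alpha> = (\<Union>\<omega>\<in>\<alpha>. cohom_class G N act n (\<lambda>gs\<in>tuples G n. f (\<omega> gs)))"


subsection \<open>Trivial and bounded-function coefficients\<close>

definition trivial_act :: "'g \<Rightarrow> 'a \<Rightarrow> 'a" where
  "trivial_act g a = a"

text \<open>The argument \<open>bdd\<close> is the notion of boundedness for subsets of \<open>A\<close>: \<^const>\<open>finite\<close> if \<open>A\<close> is
  finitely generated, and the metric notion \<^const>\<open>bounded\<close> for the real numbers.\<close>

definition linf ::
  "('a set \<Rightarrow> bool) \<Rightarrow> ('g, 'x) monoid_scheme \<Rightarrow> ('a, 'y) monoid_scheme \<Rightarrow> ('g \<Rightarrow> 'a) monoid" where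
  "linf bdd G A = (product_group (carrier G) (\<lambda>_. A))
     \<lparr>carrier := {f \<in> carrier G \<rightarrow>\<^sub>E carrier A. bdd (f ` carrier G)}\<rparr>"

definition linf_act :: "('g, 'x) monoid_scheme \<Rightarrow> 'g \<Rightarrow> ('g \<Rightarrow> 'a) \<Rightarrow> ('g \<Rightarrow> 'a)" where
  "linf_act G g f = (\<lambda>h\<in>carrier G. f (inv\<^bsub>G\<^esub> g \<otimes>\<^bsub>G\<^esub> h))"

definition const_fun :: "('g, 'x) monoid_scheme \<Rightarrow> 'a \<Rightarrow> ('g \<Rightarrow> 'a)" where
  "const_fun G a = (\<lambda>h\<in>carrier G. a)"

definition linf_cohomology ::
  "('a set \<Rightarrow> bool) \<Rightarrow> ('g, 'x) monoid_scheme \<Rightarrow> ('a, 'y) monoid_scheme \<Rightarrow> nat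
    \<Rightarrow> ('g list \<Rightarrow> 'g \<Rightarrow> 'a) set monoid" where
  "linf_cohomology bdd G A n = cohomology G (linf bdd G A) (linf_act G) n"

definition iota ::
  "('a set \<Rightarrow> bool) \<Rightarrow> ('g, 'x) monoid_scheme \<Rightarrow> ('a, 'y) monoid_scheme \<Rightarrow> nat
    \<Rightarrow> ('g list \<Rightarrow> 'a) set \<Rightarrow> ('g list \<Rightarrow> 'g \<Rightarrow> 'a) set" where
  "iota bdd G A n = coeff_map G (linf bdd G A) (linf_act G) n (const_fun G)"


subsection \<open>Weakly bounded classes\<close>

text \<open>These two notions are meant for degrees \<open>n \<ge> 1\<close>.\<close>

definition weakly_bounded_cochain ::
  "('a set \<Rightarrow> bool) \<Rightarrow> ('g, 'x) monoid_scheme \<Rightarrow> nat \<Rightarrow> ('g list \<Rightarrow> 'a) \<Rightarrow> bool" where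
  "weakly_bounded_cochain bdd G n \<omega> \<longleftrightarrow>
     (\<forall>gs\<in>tuples G (n - 1). bdd {\<omega> (g # gs) | g. g \<in> carrier G})"

definition weakly_bounded_class ::
  "('a set \<Rightarrow> bool) \<Rightarrow> ('g, 'x) monoid_scheme \<Rightarrow> ('a, 'y) monoid_scheme \<Rightarrow> nat
    \<Rightarrow> ('g list \<Rightarrow> 'a) set \<Rightarrow> bool" where
  "weakly_bounded_class bdd G A n \<alpha> \<longleftrightarrow>
     (\<exists>\<omega>\<in>cocycles G A trivial_act n.
        \<alpha> = cohom_class G A trivial_act n \<omega> \<and> weakly_bounded_cochain bdd G n \<omega>)"

end

theory Submission
  imports Defs "HOL-Analysis.Elementary_Normed_Spaces"
begin

text \<open>In additive notation, a weakly bounded n-cochain \<open>\<omega>\<close> is the same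
  thing as an (n-1)-cochain \<open>\<eta>\<close> of bounded functions, through
  \<open>\<eta>(g2, ..., gn)(h) = \<omega>(h^-1, g2, ..., gn)\<close>. Weak boundedness of
  \<open>\<omega>\<close> says exactly that each \<open>\<eta>(g2, ..., gn)\<close> is bounded. If
  \<open>\<omega>\<close> is a cocycle, its cocycle identity at \<open>(h^-1, g1, ..., gn)\<close>
  says that \<open>\<eta>\<close> is a primitive of \<open>\<omega>\<close>, viewed with values in
  the constant functions. So a weakly bounded representative makes the image of the class vanish
  (\<open>weakly_bounded_cocycle_imp_coboundary\<close>).

  Conversely, let \<open>\<eta>\<close> be a bounded primitive and let \<open>\<beta>\<close> be its
  value at the identity. Evaluation at the identity is a homomorphism but not equivariant, so
  \<open>\<delta>\<beta>\<close> differs from \<open>\<omega>\<close> only in the term that carries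
  the action. The difference \<open>\<eta>(g2, ..., gn)(g1^-1) - \<eta>(g2, ..., gn)(1)\<close> is
  bounded in g1, hence \<open>\<omega> - \<delta>\<beta>\<close> is a weakly bounded representative
  (\<open>coboundary_imp_weakly_bounded_representative\<close>). That it is again a cocycle needs
  \<open>\<delta>\<delta> = 0\<close> for trivial coefficients, which follows from the simplicial
  identities \<open>face_face\<close> and the cancellation \<open>altprod_altprod_cancel\<close>.

  Finite generation and real coefficients are treated together in the locale
  \<open>bounded_coefficients\<close>, which axiomatizes boundedness.\<close>

subsection \<open>Alternating products\<close>

text \<open>Additively this is f 0 - (f 1 - (f 2 - ...)), the alternating sum of f 0, ..., f n. The
  nesting hides the signs, so that splitting off the front term suits induction and
  simplification.\<close>

primrec altprod :: "('m, 'y) monoid_scheme \<Rightarrow> (nat \<Rightarrow> 'm) \<Rightarrow> nat \<Rightarrow> 'm" where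
  "altprod M f 0 = f 0"
| "altprod M f (Suc n) = f 0 \<otimes>\<^bsub>M\<^esub> inv\<^bsub>M\<^esub> altprod M (\<lambda>i. f (Suc i)) n"

lemma altprod_cong:
  "(\<And>i. i \<le> n \<Longrightarrow> f i = g i) \<Longrightarrow> altprod M f n = altprod M g n"
proof (induction n arbitrary: f g)
  case (Suc n)
  have "altprod M (\<lambda>i. f (Suc i)) n = altprod M (\<lambda>i. g (Suc i)) n"
    by (rule Suc.IH) (simp add: Suc.prems)
  then show ?case
    using Suc.prems[of 0] by simp
qed simp

context comm_group
begin

lemma altprod_closed [simp, intro]:
  "(\<And>i. i \<le> n \<Longrightarrow> f i \<in> carrier G) \<Longrightarrow> altprod G f n \<in> carrier G"
  by (induction n arbitrary: f) simp_all

lemma altprod_mult: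
  assumes "\<And>i. i \<le> n \<Longrightarrow> f i \<in> carrier G" "\<And>i. i \<le> n \<Longrightarrow> g i \<in> carrier G"
  shows "altprod G (\<lambda>i. f i \<otimes> g i) n = altprod G f n \<otimes> altprod G g n"
  using assms
proof (induction n arbitrary: f g)
  case (Suc n)
  have "altprod G (\<lambda>i. f (Suc i) \<otimes> g (Suc i)) n
      = altprod G (\<lambda>i. f (Suc i)) n \<otimes> altprod G (\<lambda>i. g (Suc i)) n"
    by (rule Suc.IH) (simp_all add: Suc.prems)
  then show ?case
    using Suc.prems by (simp add: inv_mult m_ac)
qed simp

lemma altprod_hom:
  assumes "comm_group H" "h \<in> hom G H" "\<And>i. i \<le> n \<Longrightarrow> f i \<in> carrier G"
  shows "h (altprod G f n) = altprod H (\<lambda>i. h (f i)) n"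
proof -
  interpret h: group_hom G H h
    using assms by (simp add: group_hom_def group_hom_axioms_def comm_group.axioms is_group)
  show ?thesis
    using assms(3) by (induction n arbitrary: f) simp_all
qed

lemma altprod_inv:
  assumes "\<And>i. i \<le> n \<Longrightarrow> f i \<in> carrier G"
  shows "altprod G (\<lambda>i. inv (f i)) n = inv altprod G f n"
proof -
  have "m_inv G \<in> hom G G"
    by (auto intro: homI simp: inv_mult)
  from altprod_hom[OF comm_group_axioms this assms] show ?thesis
    by simp
qed

text \<open>Peeling from the back makes the sign of the last term explicit; this links the nested
  form to integer powers.\<close>

lemma altprod_snoc:
  assumes "\<And>i. i \<le> Suc n \<Longrightarrow> f i \<in> carrier G"
  shows "altprod G f (Suc n) = altprod G f n \<otimes> f (Suc n) [^] ((- 1) ^ Suc n :: int)"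
  using assms
proof (induction n arbitrary: f)
  case 0
  then show ?case
    by (simp add: int_pow_neg)
next
  case (Suc n)
  have "altprod G (\<lambda>i. f (Suc i)) (Suc n)
      = altprod G (\<lambda>i. f (Suc i)) n \<otimes> f (Suc (Suc n)) [^] ((- 1) ^ Suc n :: int)"
    by (rule Suc.IH) (simp add: Suc.prems)
  moreover have "altprod G f (Suc (Suc n)) = f 0 \<otimes> inv altprod G (\<lambda>i. f (Suc i)) (Suc n)"
    by (rule altprod.simps)
  ultimately have "altprod G f (Suc (Suc n))
      = f 0 \<otimes> inv (altprod G (\<lambda>i. f (Suc i)) n \<otimes> f (Suc (Suc n)) [^] ((- 1) ^ Suc n :: int))"
    by simp
  moreover have "f (Suc (Suc n)) [^] ((- 1) ^ Suc (Suc n) :: int)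
      = inv (f (Suc (Suc n)) [^] ((- 1) ^ Suc n :: int))"
    using Suc.prems by (simp flip: int_pow_neg)
  moreover have "altprod G (\<lambda>i. f (Suc i)) n \<in> carrier G"
    using Suc.prems by simp
  ultimately show ?case
    using Suc.prems by (simp add: inv_mult m_ac del: power_Suc)
qed

text \<open>The right-hand side has the shape of the untwisted part of \<open>coboundary\<close>:
  the merged terms, then the term of the truncated tuple. The term at 0 stays outside because it is
  the one carrying the action.\<close>

lemma inv_altprod_Suc_eq_finprod:
  assumes "\<And>i. i \<le> Suc n \<Longrightarrow> f i \<in> carrier G"
  shows "inv altprod G (\<lambda>i. f (Suc i)) n
    = (\<Otimes>i\<in>{1..n}. f i [^] ((- 1) ^ i :: int)) \<otimes> f (Suc n) [^] ((- 1) ^ Suc n :: int)"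
  using assms
proof (induction n)
  case 0
  then show ?case
    by (simp add: int_pow_neg)
next
  case (Suc n)
  let ?t = "\<lambda>i. f i [^] ((- 1) ^ i :: int)"
  have "altprod G (\<lambda>i. f (Suc i)) (Suc n)
      = altprod G (\<lambda>i. f (Suc i)) n \<otimes> f (Suc (Suc n)) [^] ((- 1) ^ Suc n :: int)"
    by (rule altprod_snoc) (simp add: Suc.prems)
  moreover have "?t (Suc (Suc n)) = inv (f (Suc (Suc n)) [^] ((- 1) ^ Suc n :: int))"
    using Suc.prems by (simp flip: int_pow_neg)
  moreover have "inv altprod G (\<lambda>i. f (Suc i)) n = finprod G ?t {1..n} \<otimes> ?t (Suc n)"
    by (rule Suc.IH) (simp add: Suc.prems)
  moreover have "finprod G ?t {1..Suc n} = ?t (Suc n) \<otimes> finprod G ?t {1..n}"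
    using Suc.prems by (simp add: atLeastAtMostSuc_conv Pi_def del: power_Suc)
  moreover have "finprod G ?t {1..n} \<in> carrier G"
    using Suc.prems by (auto intro!: finprod_closed)
  moreover have "altprod G (\<lambda>i. f (Suc i)) n \<in> carrier G"
    using Suc.prems by simp
  ultimately show ?case
    using Suc.prems by (simp add: inv_mult m_ac del: power_Suc altprod.simps)
qed

text \<open>Splitting off the column \<open>j = 0\<close> and the row \<open>i = 0\<close>, whose entries agree by the second
  assumption, leaves the array \<open>a (Suc i) (Suc j)\<close>, which satisfies the same hypotheses.\<close>

lemma altprod_altprod_cancel:
  assumes "\<And>i j. i \<le> n \<Longrightarrow> j \<le> Suc n \<Longrightarrow> a i j \<in> carrier G"
    and "\<And>i j. i \<le> j \<Longrightarrow> j \<le> n \<Longrightarrow> a i (Suc j) = a j i"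
  shows "altprod G (\<lambda>j. altprod G (\<lambda>i. a i j) n) (Suc n) = \<one>"
  using assms
proof (induction n arbitrary: a)
  case 0
  then show ?case
    by simp
next
  case (Suc n)
  let ?b = "\<lambda>j. altprod G (\<lambda>i. a (Suc i) (Suc j)) n"
  let ?c = "altprod G (\<lambda>j. a j 0) (Suc n)"
  have b: "?b j \<in> carrier G" if "j \<le> Suc n" for j
    using that Suc.prems(1) by simp
  have c: "?c \<in> carrier G"
    using Suc.prems(1) by (intro altprod_closed) simp
  have IH: "altprod G ?b (Suc n) = \<one>"
    by (rule Suc.IH) (simp_all add: Suc.prems)
  have "altprod G (\<lambda>j. altprod G (\<lambda>i. a i (Suc j)) (Suc n)) (Suc n)
      = altprod G (\<lambda>j. a 0 (Suc j) \<otimes> inv ?b j) (Suc n)"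
    by simp
  also have "\<dots> = altprod G (\<lambda>j. a 0 (Suc j)) (Suc n) \<otimes> altprod G (\<lambda>j. inv ?b j) (Suc n)"
    by (rule altprod_mult) (simp_all add: b Suc.prems)
  also have "altprod G (\<lambda>j. inv ?b j) (Suc n) = inv altprod G ?b (Suc n)"
    by (rule altprod_inv) (rule b)
  also have "altprod G (\<lambda>j. a 0 (Suc j)) (Suc n) = ?c"
    by (rule altprod_cong) (simp add: Suc.prems(2))
  finally have "altprod G (\<lambda>j. altprod G (\<lambda>i. a i (Suc j)) (Suc n)) (Suc n) = ?c"
    using c by (simp add: IH del: altprod.simps)
  \<comment> \<open>Column 0 enters the outer product positively, and all later columns together
    enter as one inverse, which is that of \<open>?c\<close> again.\<close>
  then have "altprod G (\<lambda>j. altprod G (\<lambda>i. a i j) (Suc n)) (Suc (Suc n)) = ?c \<otimes> inv ?c"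
    by (subst altprod.simps(2)) (simp del: altprod.simps)
  then show ?case
    using c by (simp del: altprod.simps)
qed

end


subsection \<open>Face maps\<close>

text \<open>The faces indexed by \<open>0\<close> and by the length drop the first and the last entry.\<close>

fun face :: "('g, 'x) monoid_scheme \<Rightarrow> nat \<Rightarrow> 'g list \<Rightarrow> 'g list" where
  "face G i [] = []"
| "face G 0 (x # xs) = xs"
| "face G (Suc 0) [x] = []"
| "face G (Suc 0) (x # y # ys) = (x \<otimes>\<^bsub>G\<^esub> y) # ys"
| "face G (Suc (Suc i)) (x # xs) = x # face G (Suc i) xs"

lemma face_eq_merge: "1 \<le> i \<Longrightarrow> i < length gs \<Longrightarrow> face G i gs = merge G i gs"
  by (induction G i gs rule: face.induct) (simp_all add: merge_def)

lemma face_length: "gs \<noteq> [] \<Longrightarrow> face G (length gs) gs = butlast gs"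
proof (induction gs)
  case (Cons x xs)
  then show ?case
    by (cases xs) auto
qed simp

lemma length_face: "i \<le> length gs \<Longrightarrow> length (face G i gs) = length gs - 1"
  by (induction G i gs rule: face.induct) auto

lemma set_face: "group G \<Longrightarrow> set gs \<subseteq> carrier G \<Longrightarrow> set (face G i gs) \<subseteq> carrier G"
  by (induction G i gs rule: face.induct) (auto intro: monoid.m_closed group.is_monoid)

lemma (in group) face_tuples:
  "gs \<in> tuples G (Suc n) \<Longrightarrow> i \<le> Suc n \<Longrightarrow> face G i gs \<in> tuples G n"
  using set_face[of G gs i] is_group by (auto simp: tuples_def length_face)

text \<open>A simplicial identity of the bar construction. Stripping the common head reduces it to
  small indices; there the case i = j = 1 with at least three entries is associativity.\<close>

lemma (in group) face_face:
  "set gs \<subseteq> carrier G \<Longrightarrow> i \<le> j \<Longrightarrow> j < length gs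
    \<Longrightarrow> face G i (face G (Suc j) gs) = face G j (face G i gs)"
proof (induction gs arbitrary: i j)
  case (Cons x xs)
  show ?case
  proof (cases i)
    case 0
    with Cons.prems show ?thesis
      by (cases j; cases xs) auto
  next
    case (Suc i')
    with Cons.prems obtain j' where j: "j = Suc j'"
      by (cases j) auto
    obtain y ys where xs: "xs = y # ys"
      using Cons.prems j by (cases xs) auto
    show ?thesis
    proof (cases i')
      case 0
      with Suc j xs Cons.prems show ?thesis
        by (cases j'; cases ys) (auto simp: m_assoc)
    next
      case (Suc i'')
      then obtain j'' where j'': "j' = Suc j''"
        using \<open>i = Suc i'\<close> j Cons.prems by (cases j') auto
      have "face G i' (face G (Suc j') xs) = face G j' (face G i' xs)"
        using Cons.prems \<open>i = Suc i'\<close> j by (intro Cons.IH) auto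
      then show ?thesis
        by (simp add: \<open>i = Suc i'\<close> j Suc j'')
    qed
  qed
qed simp


subsection \<open>The bar complex of a module\<close>

locale bar_complex = G: group G + M: comm_group M
  for G :: "('g, 'x) monoid_scheme" and M :: "('m, 'y) monoid_scheme" +
  fixes act :: "'g \<Rightarrow> 'm \<Rightarrow> 'm"
  assumes act_hom: "g \<in> carrier G \<Longrightarrow> act g \<in> hom M M"
begin

lemma act_closed: "g \<in> carrier G \<Longrightarrow> m \<in> carrier M \<Longrightarrow> act g m \<in> carrier M"
  using act_hom by (auto simp: hom_def)

lemma carrier_cochains: "carrier (cochains G M n) = (tuples G n \<rightarrow>\<^sub>E carrier M)"
  by (simp add: cochains_def)

lemma cochain_closed [intro]:
  "\<omega> \<in> carrier (cochains G M n) \<Longrightarrow> gs \<in> tuples G n \<Longrightarrow> \<omega> gs \<in> carrier M"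
  by (auto simp: carrier_cochains)

lemma cochain_eqI:
  assumes "\<omega> \<in> carrier (cochains G M n)" "\<eta> \<in> carrier (cochains G M n)"
    and "\<And>gs. gs \<in> tuples G n \<Longrightarrow> \<omega> gs = \<eta> gs"
  shows "\<omega> = \<eta>"
  using assms by (auto simp: carrier_cochains intro: PiE_ext)

lemma cochain_mult:
  "gs \<in> tuples G n \<Longrightarrow> (\<omega> \<otimes>\<^bsub>cochains G M n\<^esub> \<eta>) gs = \<omega> gs \<otimes>\<^bsub>M\<^esub> \<eta> gs"
  by (simp add: cochains_def)

lemma cochain_one: "gs \<in> tuples G n \<Longrightarrow> \<one>\<^bsub>cochains G M n\<^esub> gs = \<one>\<^bsub>M\<^esub>"
  by (simp add: cochains_def)

lemma cochain_inv:
  "\<omega> \<in> carrier (cochains G M n) \<Longrightarrow> gs \<in> tuples G n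
    \<Longrightarrow> (inv\<^bsub>cochains G M n\<^esub> \<omega>) gs = inv\<^bsub>M\<^esub> \<omega> gs"
  by (simp add: cochains_def M.is_group)

lemma comm_group_cochains: "comm_group (cochains G M n)"
proof -
  interpret C: group "cochains G M n"
    by (simp add: cochains_def M.is_group)
  show ?thesis
  proof (rule C.group_comm_groupI)
    fix \<omega> \<eta>
    assume \<omega>\<eta>: "\<omega> \<in> carrier (cochains G M n)" "\<eta> \<in> carrier (cochains G M n)"
    then show "\<omega> \<otimes>\<^bsub>cochains G M n\<^esub> \<eta> = \<eta> \<otimes>\<^bsub>cochains G M n\<^esub> \<omega>"
      by (intro cochain_eqI[of _ n]) (auto simp: cochain_mult M.m_comm cochain_closed)
  qed
qed

text \<open>The middle terms of the definition are the inner faces and \<open>butlast\<close> is the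
  last face, so everything except the twisted term collects into one alternating product. Later
  computations use this form.\<close>

lemma coboundary_altprod:
  assumes "\<omega> \<in> carrier (cochains G M n)" "gs \<in> tuples G (Suc n)"
  shows "coboundary G M act n \<omega> gs
    = act (hd gs) (\<omega> (tl gs)) \<otimes>\<^bsub>M\<^esub> inv\<^bsub>M\<^esub> altprod M (\<lambda>i. \<omega> (face G (Suc i) gs)) n"
proof -
  have len: "length gs = Suc n"
    using assms by (simp add: tuples_def)
  have cl: "\<omega> (face G i gs) \<in> carrier M" if "i \<le> Suc n" for i
    using assms that by (intro cochain_closed G.face_tuples)
  have hd: "act (hd gs) (\<omega> (tl gs)) \<in> carrier M"
  proof (rule act_closed)
    show "hd gs \<in> carrier G"
      using assms(2) by (cases gs) (auto simp: tuples_def)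
    show "\<omega> (tl gs) \<in> carrier M"
      using cl[of 0] len by (cases gs) auto
  qed
  let ?t = "\<lambda>i. \<omega> (face G i gs) [^]\<^bsub>M\<^esub> ((- 1) ^ i :: int)"
  have "finprod M (\<lambda>i. \<omega> (merge G i gs) [^]\<^bsub>M\<^esub> ((- 1) ^ i :: int)) {1..n} = finprod M ?t {1..n}"
    by (rule M.finprod_cong') (use len in \<open>auto simp: cl face_eq_merge[symmetric]\<close>)
  moreover have "butlast gs = face G (Suc n) gs"
    using face_length[of gs G] len by (cases gs) auto
  moreover have "finprod M ?t {1..n} \<in> carrier M"
    by (rule M.finprod_closed) (auto simp: cl)
  ultimately show ?thesis
    using assms hd cl[of "Suc n"]
      M.inv_altprod_Suc_eq_finprod[of n "\<lambda>i. \<omega> (face G i gs)", OF cl]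
    by (simp add: coboundary_def M.m_assoc del: power_Suc)
qed

lemma coboundary_closed:
  assumes "\<omega> \<in> carrier (cochains G M n)"
  shows "coboundary G M act n \<omega> \<in> carrier (cochains G M (Suc n))"
proof -
  have "coboundary G M act n \<omega> gs \<in> carrier M" if gs: "gs \<in> tuples G (Suc n)" for gs
  proof -
    have "\<omega> (face G i gs) \<in> carrier M" if "i \<le> Suc n" for i
      using assms gs that by (intro cochain_closed G.face_tuples)
    moreover have "hd gs \<in> carrier G" "tl gs \<in> tuples G n"
      using gs by (cases gs; auto simp: tuples_def)+
    ultimately show ?thesis
      using assms gs by (simp add: coboundary_altprod act_closed cochain_closed)
  qed
  moreover have "coboundary G M act n \<omega> \<in> extensional (tuples G (Suc n))"
    by (simp add: coboundary_def)
  ultimately show ?thesis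
    by (auto simp: carrier_cochains PiE_def)
qed

lemma coboundary_hom: "coboundary G M act n \<in> hom (cochains G M n) (cochains G M (Suc n))"
proof (rule homI)
  fix \<omega> \<eta>
  assume \<omega>: "\<omega> \<in> carrier (cochains G M n)" and \<eta>: "\<eta> \<in> carrier (cochains G M n)"
  interpret C: comm_group "cochains G M n"
    by (rule comm_group_cochains)
  interpret D: comm_group "cochains G M (Suc n)"
    by (rule comm_group_cochains)
  show "coboundary G M act n (\<omega> \<otimes>\<^bsub>cochains G M n\<^esub> \<eta>)
      = coboundary G M act n \<omega> \<otimes>\<^bsub>cochains G M (Suc n)\<^esub> coboundary G M act n \<eta>"
  proof (rule cochain_eqI)
    fix gs assume gs: "gs \<in> tuples G (Suc n)"
    have face: "face G (Suc i) gs \<in> tuples G n" if "i \<le> n" for i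
      using gs that by (intro G.face_tuples) simp_all
    have tl: "hd gs \<in> carrier G" "tl gs \<in> tuples G n"
      using gs by (cases gs; auto simp: tuples_def)+
    have cl: "\<omega> (face G (Suc i) gs) \<in> carrier M" "\<eta> (face G (Suc i) gs) \<in> carrier M"
      if "i \<le> n" for i
      using \<omega> \<eta> face[OF that] by auto
    have "altprod M (\<lambda>i. (\<omega> \<otimes>\<^bsub>cochains G M n\<^esub> \<eta>) (face G (Suc i) gs)) n
        = altprod M (\<lambda>i. \<omega> (face G (Suc i) gs) \<otimes>\<^bsub>M\<^esub> \<eta> (face G (Suc i) gs)) n"
      by (rule altprod_cong) (simp add: cochain_mult face)
    also have "\<dots> = altprod M (\<lambda>i. \<omega> (face G (Suc i) gs)) n
        \<otimes>\<^bsub>M\<^esub> altprod M (\<lambda>i. \<eta> (face G (Suc i) gs)) n"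
      by (rule M.altprod_mult) (simp_all add: cl)
    finally have 1: "altprod M (\<lambda>i. (\<omega> \<otimes>\<^bsub>cochains G M n\<^esub> \<eta>) (face G (Suc i) gs)) n = \<dots>" .
    have 2: "act (hd gs) (\<omega> (tl gs) \<otimes>\<^bsub>M\<^esub> \<eta> (tl gs))
        = act (hd gs) (\<omega> (tl gs)) \<otimes>\<^bsub>M\<^esub> act (hd gs) (\<eta> (tl gs))"
      using act_hom[OF tl(1)] \<omega> \<eta> tl(2) by (intro hom_mult) auto
    have 3: "act (hd gs) (\<omega> (tl gs)) \<in> carrier M" "act (hd gs) (\<eta> (tl gs)) \<in> carrier M"
      using \<omega> \<eta> tl by (auto intro: act_closed)
    show "coboundary G M act n (\<omega> \<otimes>\<^bsub>cochains G M n\<^esub> \<eta>) gs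
        = (coboundary G M act n \<omega> \<otimes>\<^bsub>cochains G M (Suc n)\<^esub> coboundary G M act n \<eta>) gs"
      using \<omega> \<eta> gs tl 3 cl
      by (simp add: cochain_mult coboundary_altprod 1 2 M.inv_mult M.m_ac)
  qed (simp_all add: \<omega> \<eta> coboundary_closed)
qed (rule coboundary_closed)

lemma group_hom_coboundary:
  "group_hom (cochains G M n) (cochains G M (Suc n)) (coboundary G M act n)"
  by (simp add: group_hom_def group_hom_axioms_def coboundary_hom comm_group.axioms
      comm_group_cochains)

lemma subgroup_cocycles: "subgroup (cocycles G M act n) (cochains G M n)"
  unfolding cocycles_def by (rule group_hom.subgroup_kernel[OF group_hom_coboundary])

lemma subgroup_coboundaries: "subgroup (coboundaries G M act n) (cochains G M n)"
proof (cases n)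
  case 0
  then show ?thesis
    by (simp add: coboundaries_def group.triv_subgroup comm_group.axioms comm_group_cochains)
next
  case (Suc k)
  then show ?thesis
    by (simp add: coboundaries_def group_hom.img_is_subgroup[OF group_hom_coboundary])
qed

lemma cohom_class_eq:
  assumes "\<omega> \<in> carrier (cochains G M n)" "\<eta> \<in> cohom_class G M act n \<omega>"
  shows "cohom_class G M act n \<eta> = cohom_class G M act n \<omega>"
proof -
  interpret C: comm_group "cochains G M n"
    by (rule comm_group_cochains)
  show ?thesis
    using assms subgroup_coboundaries[of n] unfolding cohom_class_def
    by (intro C.repr_independence[symmetric])
qed

lemma cohom_class_self:
  assumes "\<omega> \<in> carrier (cochains G M n)"
  shows "\<omega> \<in> cohom_class G M act n \<omega>"
proof -
  interpret C: comm_group "cochains G M n"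
    by (rule comm_group_cochains)
  show ?thesis
    using assms subgroup_coboundaries[of n] unfolding cohom_class_def
    by (intro C.rcos_self)
qed

lemma cohom_class_coboundary:
  assumes "\<omega> \<in> coboundaries G M act n"
  shows "cohom_class G M act n \<omega> = coboundaries G M act n"
proof -
  interpret C: comm_group "cochains G M n"
    by (rule comm_group_cochains)
  show ?thesis
    using assms subgroup.mem_carrier[OF subgroup_coboundaries] subgroup_coboundaries[of n]
    unfolding cohom_class_def by (intro C.coset_join2)
qed

end

section \<open>Maps of bar complexes induced by equivariant homomorphisms\<close>

locale bar_complex_hom = M: bar_complex G M act + N: bar_complex G N act'
  for G :: "('g, 'x) monoid_scheme" and M :: "('m, 'y) monoid_scheme" and act
    and N :: "('k, 'z) monoid_scheme" and act' +
  fixes f :: "'m \<Rightarrow> 'k"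
  assumes f_hom: "f \<in> hom M N"
    and equivariant: "g \<in> carrier G \<Longrightarrow> m \<in> carrier M \<Longrightarrow> f (act g m) = act' g (f m)"
begin

lemma f_closed: "m \<in> carrier M \<Longrightarrow> f m \<in> carrier N"
  using f_hom by (auto simp: hom_def)

lemma image_cochain:
  "\<omega> \<in> carrier (cochains G M n) \<Longrightarrow> (\<lambda>gs\<in>tuples G n. f (\<omega> gs)) \<in> carrier (cochains G N n)"
  by (auto simp: M.carrier_cochains N.carrier_cochains intro: f_closed)

text \<open>A homomorphism passes through the alternating product of faces, and equivariance takes
  care of the twisted first term: \<open>f\<close> induces a cochain map.\<close>

lemma image_coboundary:
  assumes \<omega>: "\<omega> \<in> carrier (cochains G M n)"
  shows "(\<lambda>gs\<in>tuples G (Suc n). f (coboundary G M act n \<omega> gs))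
    = coboundary G N act' n (\<lambda>gs\<in>tuples G n. f (\<omega> gs))" (is "?l = ?r")
proof (rule N.cochain_eqI)
  show "?l \<in> carrier (cochains G N (Suc n))"
    by (intro image_cochain M.coboundary_closed \<omega>)
  show "?r \<in> carrier (cochains G N (Suc n))"
    by (intro image_cochain N.coboundary_closed \<omega>)
  fix gs assume gs: "gs \<in> tuples G (Suc n)"
  interpret f: group_hom M N f
    by unfold_locales (rule f_hom)
  have face: "face G (Suc i) gs \<in> tuples G n" if "i \<le> n" for i
    using gs that by (intro M.G.face_tuples) simp_all
  have tl: "hd gs \<in> carrier G" "tl gs \<in> tuples G n"
    using gs by (cases gs; auto simp: tuples_def)+
  have cl: "\<omega> (face G (Suc i) gs) \<in> carrier M" if "i \<le> n" for i
    using \<omega> face[OF that] by auto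
  have "altprod N (\<lambda>i. f (\<omega> (face G (Suc i) gs))) n
      = altprod N (\<lambda>i. (\<lambda>gs\<in>tuples G n. f (\<omega> gs)) (face G (Suc i) gs)) n"
    by (rule altprod_cong) (simp add: face)
  then have "f (altprod M (\<lambda>i. \<omega> (face G (Suc i) gs)) n)
      = altprod N (\<lambda>i. (\<lambda>gs\<in>tuples G n. f (\<omega> gs)) (face G (Suc i) gs)) n"
    using M.M.altprod_hom[OF N.M.comm_group_axioms f_hom, of n "\<lambda>i. \<omega> (face G (Suc i) gs)"] cl
    by simp
  moreover have "\<omega> (tl gs) \<in> carrier M"
    using \<omega> tl by auto
  moreover have "altprod M (\<lambda>i. \<omega> (face G (Suc i) gs)) n \<in> carrier M"
    using cl by auto
  ultimately show "?l gs = ?r gs"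
    using gs tl
    by (simp add: M.coboundary_altprod[OF \<omega>] N.coboundary_altprod[OF image_cochain[OF \<omega>]]
        M.act_closed equivariant)
qed

lemma image_mult:
  assumes "\<omega> \<in> carrier (cochains G M n)" "\<eta> \<in> carrier (cochains G M n)"
  shows "(\<lambda>gs\<in>tuples G n. f ((\<omega> \<otimes>\<^bsub>cochains G M n\<^esub> \<eta>) gs))
    = (\<lambda>gs\<in>tuples G n. f (\<omega> gs)) \<otimes>\<^bsub>cochains G N n\<^esub> (\<lambda>gs\<in>tuples G n. f (\<eta> gs))"
  using assms
  by (auto simp: cochains_def intro!: restrict_ext hom_mult[OF f_hom])

lemma image_coboundaries:
  assumes "\<omega> \<in> coboundaries G M act n"
  shows "(\<lambda>gs\<in>tuples G n. f (\<omega> gs)) \<in> coboundaries G N act' n"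
proof (cases n)
  case 0
  have "f \<one>\<^bsub>M\<^esub> = \<one>\<^bsub>N\<^esub>"
    by (rule hom_one[OF f_hom M.M.is_group N.M.is_group])
  with 0 assms show ?thesis
    by (auto simp: coboundaries_def cochains_def)
next
  case (Suc k)
  with assms obtain \<beta> where \<beta>: "\<beta> \<in> carrier (cochains G M k)" "\<omega> = coboundary G M act k \<beta>"
    by (auto simp: coboundaries_def)
  then show ?thesis
    using image_cochain[OF \<beta>(1)] by (simp add: coboundaries_def Suc image_coboundary)
qed

lemma image_cohom_class:
  assumes \<omega>: "\<omega> \<in> carrier (cochains G M n)" and \<eta>: "\<eta> \<in> cohom_class G M act n \<omega>"
  shows "(\<lambda>gs\<in>tuples G n. f (\<eta> gs)) \<in> cohom_class G N act' n (\<lambda>gs\<in>tuples G n. f (\<omega> gs))"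
proof -
  from \<eta> obtain \<beta> where \<beta>: "\<beta> \<in> coboundaries G M act n" and "\<eta> = \<beta> \<otimes>\<^bsub>cochains G M n\<^esub> \<omega>"
    by (auto simp: cohom_class_def r_coset_def)
  then have "(\<lambda>gs\<in>tuples G n. f (\<eta> gs))
      = (\<lambda>gs\<in>tuples G n. f (\<beta> gs)) \<otimes>\<^bsub>cochains G N n\<^esub> (\<lambda>gs\<in>tuples G n. f (\<omega> gs))"
    using \<omega> subgroup.mem_carrier[OF M.subgroup_coboundaries] by (simp add: image_mult)
  then show ?thesis
    using image_coboundaries[OF \<beta>] by (auto simp: cohom_class_def r_coset_def)
qed

text \<open>All members of the union in \<open>coeff_map\<close> coincide by
  \<open>image_cohom_class\<close>, and the class is nonempty, so the union collapses to the class
  of one image.\<close>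

lemma coeff_map_cohom_class:
  assumes \<omega>: "\<omega> \<in> carrier (cochains G M n)"
  shows "coeff_map G N act' n f (cohom_class G M act n \<omega>)
    = cohom_class G N act' n (\<lambda>gs\<in>tuples G n. f (\<omega> gs))"
proof -
  have "cohom_class G N act' n (\<lambda>gs\<in>tuples G n. f (\<eta> gs))
      = cohom_class G N act' n (\<lambda>gs\<in>tuples G n. f (\<omega> gs))"
    if "\<eta> \<in> cohom_class G M act n \<omega>" for \<eta>
    using that by (intro N.cohom_class_eq image_cohom_class image_cochain \<omega>)
  with M.cohom_class_self[OF \<omega>] show ?thesis
    unfolding coeff_map_def by blast
qed

end


subsection \<open>Bounded functions\<close>

text \<open>The axioms are what finite sets and metrically bounded sets of reals have in common:
  singletons are bounded, and subsets, products and inverses of bounded sets stay bounded.\<close>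

locale bounded_coefficients = G: group G + A: comm_group A
  for G :: "('g, 'x) monoid_scheme" and A :: "('a, 'y) monoid_scheme" +
  fixes bdd :: "'a set \<Rightarrow> bool"
  assumes bdd_singleton: "bdd {a}"
    and bdd_subset: "bdd T \<Longrightarrow> S \<subseteq> T \<Longrightarrow> bdd S"
    and bdd_mult: "S \<subseteq> carrier A \<Longrightarrow> T \<subseteq> carrier A \<Longrightarrow> bdd S \<Longrightarrow> bdd T \<Longrightarrow> bdd (S <#>\<^bsub>A\<^esub> T)"
    and bdd_inv: "S \<subseteq> carrier A \<Longrightarrow> bdd S \<Longrightarrow> bdd (m_inv A ` S)"
begin

abbreviation L :: "('g \<Rightarrow> 'a) monoid" where "L \<equiv> linf bdd G A"

lemma carrier_linf: "f \<in> carrier L \<longleftrightarrow> f \<in> carrier G \<rightarrow>\<^sub>E carrier A \<and> bdd (f ` carrier G)"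
  by (simp add: linf_def)

lemma linf_closed: "f \<in> carrier L \<Longrightarrow> h \<in> carrier G \<Longrightarrow> f h \<in> carrier A"
  by (auto simp: carrier_linf)

lemma linf_eqI:
  "f \<in> carrier L \<Longrightarrow> f' \<in> carrier L \<Longrightarrow> (\<And>h. h \<in> carrier G \<Longrightarrow> f h = f' h) \<Longrightarrow> f = f'"
  by (auto simp: carrier_linf intro: PiE_ext)

lemma linf_mult: "h \<in> carrier G \<Longrightarrow> (f \<otimes>\<^bsub>L\<^esub> f') h = f h \<otimes>\<^bsub>A\<^esub> f' h"
  by (simp add: linf_def product_group_def)

text \<open>The range of a pointwise product lies in the product of the two ranges, and inversion
  acts on the range elementwise.\<close>

lemma subgroup_linf: "subgroup (carrier L) (product_group (carrier G) (\<lambda>_. A))"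
proof -
  interpret P: group "product_group (carrier G) (\<lambda>_. A)"
    by (simp add: A.is_group)
  show ?thesis
  proof (rule P.subgroupI)
    show "carrier L \<subseteq> carrier (product_group (carrier G) (\<lambda>_. A))"
      by (auto simp: carrier_linf)
    have "(\<lambda>_\<in>carrier G. \<one>\<^bsub>A\<^esub>) \<in> carrier L"
      by (auto simp: carrier_linf intro: bdd_subset[OF bdd_singleton[of "\<one>\<^bsub>A\<^esub>"]])
    then show "carrier L \<noteq> {}"
      by blast
  next
    fix f assume f: "f \<in> carrier L"
    then have *: "inv\<^bsub>product_group (carrier G) (\<lambda>_. A)\<^esub> f = (\<lambda>h\<in>carrier G. inv\<^bsub>A\<^esub> f h)"
      by (simp add: carrier_linf A.is_group)
    have "bdd (m_inv A ` f ` carrier G)"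
      using f by (intro bdd_inv) (auto simp: carrier_linf)
    then show "inv\<^bsub>product_group (carrier G) (\<lambda>_. A)\<^esub> f \<in> carrier L"
      unfolding * using f by (auto simp: carrier_linf image_image cong: image_cong)
  next
    fix f f' assume f: "f \<in> carrier L" and f': "f' \<in> carrier L"
    have "bdd ((f ` carrier G) <#>\<^bsub>A\<^esub> (f' ` carrier G))"
      using f f' by (intro bdd_mult) (auto simp: carrier_linf)
    then have "bdd ((\<lambda>h. f h \<otimes>\<^bsub>A\<^esub> f' h) ` carrier G)"
      by (rule bdd_subset) (auto simp: set_mult_def)
    then show "f \<otimes>\<^bsub>product_group (carrier G) (\<lambda>_. A)\<^esub> f' \<in> carrier L"
      using f f' by (auto simp: carrier_linf cong: image_cong)
  qed
qed

lemma comm_group_linf: "comm_group L"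
proof -
  have L: "L = (product_group (carrier G) (\<lambda>_. A))\<lparr>carrier := carrier L\<rparr>"
    by (simp add: linf_def)
  have "group L"
    by (subst L) (rule subgroup.subgroup_is_group[OF subgroup_linf], simp add: A.is_group)
  then interpret L: group L .
  show ?thesis
  proof (rule L.group_comm_groupI)
    fix f f' assume "f \<in> carrier L" "f' \<in> carrier L"
    then show "f \<otimes>\<^bsub>L\<^esub> f' = f' \<otimes>\<^bsub>L\<^esub> f"
      by (intro linf_eqI) (auto simp: linf_mult linf_closed A.m_comm)
  qed
qed

lemma eval_hom: "h \<in> carrier G \<Longrightarrow> (\<lambda>f. f h) \<in> hom L A"
  by (rule homI) (simp_all add: linf_closed linf_mult)

text \<open>Translating the argument does not enlarge the range.\<close>

lemma linf_act_closed:
  assumes "g \<in> carrier G" "f \<in> carrier L"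
  shows "linf_act G g f \<in> carrier L"
proof -
  have "linf_act G g f ` carrier G \<subseteq> f ` carrier G"
    using assms by (auto simp: linf_act_def)
  then have "bdd (linf_act G g f ` carrier G)"
    using assms by (auto simp: carrier_linf intro: bdd_subset)
  then show ?thesis
    using assms by (auto simp: carrier_linf linf_act_def)
qed

sublocale triv: bar_complex G A trivial_act
  by unfold_locales (auto simp: hom_def trivial_act_def)

sublocale linf: bar_complex G L "linf_act G"
proof -
  interpret L: comm_group L
    by (rule comm_group_linf)
  show "bar_complex G L (linf_act G)"
  proof unfold_locales
    fix g assume g: "g \<in> carrier G"
    show "linf_act G g \<in> hom L L"
    proof (rule homI)
      fix f f' assume f: "f \<in> carrier L" "f' \<in> carrier L"
      with g show "linf_act G g (f \<otimes>\<^bsub>L\<^esub> f') = linf_act G g f \<otimes>\<^bsub>L\<^esub> linf_act G g f'"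
        by (intro linf_eqI) (auto simp: linf_act_closed linf_mult, auto simp: linf_act_def linf_mult)
    qed (simp add: g linf_act_closed)
  qed
qed

lemma const_fun_closed: "a \<in> carrier A \<Longrightarrow> const_fun G a \<in> carrier L"
  by (auto simp: carrier_linf const_fun_def intro: bdd_subset[OF bdd_singleton[of a]])

sublocale const: bar_complex_hom G A trivial_act L "linf_act G" "const_fun G"
proof unfold_locales
  show "const_fun G \<in> hom A L"
  proof (rule homI)
    fix a b assume "a \<in> carrier A" "b \<in> carrier A"
    then show "const_fun G (a \<otimes>\<^bsub>A\<^esub> b) = const_fun G a \<otimes>\<^bsub>L\<^esub> const_fun G b"
      by (intro linf_eqI) (auto simp: const_fun_closed linf_mult, auto simp: const_fun_def)
  qed (rule const_fun_closed)
  show "const_fun G (trivial_act g m) = linf_act G g (const_fun G m)" if "g \<in> carrier G" for g m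
    using that by (auto simp: const_fun_def linf_act_def trivial_act_def)
qed

text \<open>Evaluation at \<open>h\<close> is a homomorphism from \<open>L\<close> to
  \<open>A\<close>, so identities between bounded functions become identities in \<open>A\<close>.
  The action is visible only as the shifted argument in the first term.\<close>

lemma coboundary_linf_apply:
  assumes \<eta>: "\<eta> \<in> carrier (cochains G L n)" and gs: "gs \<in> tuples G (Suc n)" and h: "h \<in> carrier G"
  shows "coboundary G L (linf_act G) n \<eta> gs h
    = \<eta> (tl gs) (inv\<^bsub>G\<^esub> (hd gs) \<otimes>\<^bsub>G\<^esub> h)
      \<otimes>\<^bsub>A\<^esub> inv\<^bsub>A\<^esub> altprod A (\<lambda>i. \<eta> (face G (Suc i) gs) h) n"
proof -
  interpret ev: group_hom L A "\<lambda>f. f h"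
    by unfold_locales (rule eval_hom[OF h])
  have cl: "\<eta> (face G (Suc i) gs) \<in> carrier L" if "i \<le> n" for i
    using \<eta> gs that by (intro linf.cochain_closed G.face_tuples) auto
  then have alt: "altprod L (\<lambda>i. \<eta> (face G (Suc i) gs)) n \<in> carrier L"
    by auto
  have tl: "hd gs \<in> carrier G" "tl gs \<in> tuples G n"
    using gs by (cases gs; auto simp: tuples_def)+
  have "altprod L (\<lambda>i. \<eta> (face G (Suc i) gs)) n h = altprod A (\<lambda>i. \<eta> (face G (Suc i) gs) h) n"
    using cl by (intro linf.M.altprod_hom[OF A.comm_group_axioms eval_hom[OF h]])
  moreover have "linf_act G (hd gs) (\<eta> (tl gs)) h = \<eta> (tl gs) (inv\<^bsub>G\<^esub> (hd gs) \<otimes>\<^bsub>G\<^esub> h)"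
    using h by (simp add: linf_act_def)
  ultimately show ?thesis
    using ev.hom_inv[OF alt] by (simp add: linf.coboundary_altprod[OF \<eta> gs] linf_mult h)
qed

section \<open>The square of the coboundary for trivial coefficients\<close>

lemma coboundary_triv_eq_altprod:
  assumes \<omega>: "\<omega> \<in> carrier (cochains G A n)" and gs: "gs \<in> tuples G (Suc n)"
  shows "coboundary G A trivial_act n \<omega> gs = altprod A (\<lambda>i. \<omega> (face G i gs)) (Suc n)"
proof -
  have "face G 0 gs = tl gs"
    by (cases gs) auto
  then show ?thesis
    by (simp add: triv.coboundary_altprod[OF \<omega> gs] trivial_act_def)
qed

text \<open>Expanding twice gives the array of iterated faces \<open>?a i j\<close>, whose symmetry
  is the simplicial identity \<open>face_face\<close>; such an array cancels by
  \<open>altprod_altprod_cancel\<close>.\<close>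

lemma coboundary_coboundary_triv:
  assumes \<omega>: "\<omega> \<in> carrier (cochains G A n)"
  shows "coboundary G A trivial_act (Suc n) (coboundary G A trivial_act n \<omega>)
    = \<one>\<^bsub>cochains G A (Suc (Suc n))\<^esub>" (is "?l = _")
proof (rule triv.cochain_eqI)
  interpret C: comm_group "cochains G A (Suc (Suc n))"
    by (rule triv.comm_group_cochains)
  show "\<one>\<^bsub>cochains G A (Suc (Suc n))\<^esub> \<in> carrier (cochains G A (Suc (Suc n)))"
    by simp
  show "?l \<in> carrier (cochains G A (Suc (Suc n)))"
    by (intro triv.coboundary_closed \<omega>)
  fix gs assume gs: "gs \<in> tuples G (Suc (Suc n))"
  have set: "set gs \<subseteq> carrier G" "length gs = Suc (Suc n)"
    using gs by (auto simp: tuples_def)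
  let ?a = "\<lambda>i j. \<omega> (face G i (face G j gs))"
  have "?l gs = altprod A (\<lambda>j. coboundary G A trivial_act n \<omega> (face G j gs)) (Suc (Suc n))"
    by (rule coboundary_triv_eq_altprod[OF triv.coboundary_closed[OF \<omega>] gs])
  also have "\<dots> = altprod A (\<lambda>j. altprod A (\<lambda>i. ?a i j) (Suc n)) (Suc (Suc n))"
    by (rule altprod_cong) (intro coboundary_triv_eq_altprod[OF \<omega>] G.face_tuples gs)
  also have "\<dots> = \<one>\<^bsub>A\<^esub>"
  proof (rule A.altprod_altprod_cancel)
    show "?a i j \<in> carrier A" if "i \<le> Suc n" "j \<le> Suc (Suc n)" for i j
      using that by (intro triv.cochain_closed[OF \<omega>] G.face_tuples gs)
    show "?a i (Suc j) = ?a j i" if "i \<le> j" "j \<le> Suc n" for i j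
      using that set by (simp add: G.face_face)
  qed
  finally show "?l gs = \<one>\<^bsub>cochains G A (Suc (Suc n))\<^esub> gs"
    by (simp add: triv.cochain_one gs)
qed

lemma coboundaries_triv_subset_cocycles:
  "coboundaries G A trivial_act (Suc n) \<subseteq> cocycles G A trivial_act (Suc n)"
  using coboundary_coboundary_triv triv.coboundary_closed
  by (auto simp: coboundaries_def cocycles_def kernel_def)


subsection \<open>Weak boundedness and vanishing in bounded cohomology\<close>

text \<open>A primitive of the constant extension of \<open>\<omega>\<close> is \<open>\<eta>(g\<^sub>2, \<dots>)(h) = \<omega>(h\<^sup>-\<^sup>1, g\<^sub>2, \<dots>)\<close>: the
  identity \<open>\<delta>\<eta> = \<omega>\<close> at \<open>(g\<^sub>1, \<dots>)\<close> and \<open>h\<close> is the cocycle identity at \<open>(h\<^sup>-\<^sup>1, g\<^sub>1, \<dots>)\<close>.\<close>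

lemma weakly_bounded_cocycle_imp_coboundary:
  assumes \<omega>: "\<omega> \<in> cocycles G A trivial_act (Suc n)"
    and wb: "weakly_bounded_cochain bdd G (Suc n) \<omega>"
  shows "(\<lambda>gs\<in>tuples G (Suc n). const_fun G (\<omega> gs)) \<in> coboundaries G L (linf_act G) (Suc n)"
    (is "?c \<in> _")
proof -
  define \<eta> where "\<eta> = (\<lambda>gs\<in>tuples G n. \<lambda>h\<in>carrier G. \<omega> (inv\<^bsub>G\<^esub> h # gs))"
  have \<omega>C: "\<omega> \<in> carrier (cochains G A (Suc n))"
    and \<omega>0: "coboundary G A trivial_act (Suc n) \<omega> = \<one>\<^bsub>cochains G A (Suc (Suc n))\<^esub>"
    using \<omega> by (auto simp: cocycles_def kernel_def)
  have \<omega>cl: "\<omega> (h # gs) \<in> carrier A" if "h \<in> carrier G" "gs \<in> tuples G n" for h gs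
    using that by (intro triv.cochain_closed[OF \<omega>C]) (auto simp: tuples_def)
  have \<eta>: "\<eta> \<in> carrier (cochains G L n)"
  proof -
    have "\<eta> gs \<in> carrier L" if gs: "gs \<in> tuples G n" for gs
    proof -
      \<comment> \<open>The values of \<open>\<eta> gs\<close> are values of \<open>\<omega>\<close>
        with \<open>gs\<close> fixed behind the first entry, so weak boundedness is what places
        \<open>\<eta> gs\<close> in \<open>L\<close>.\<close>
      have "bdd {\<omega> (g # gs) | g. g \<in> carrier G}"
        using wb gs by (auto simp: weakly_bounded_cochain_def)
      then have "bdd (\<eta> gs ` carrier G)"
        by (rule bdd_subset) (use gs in \<open>auto simp: \<eta>_def\<close>)
      then show ?thesis
        using gs by (auto simp: carrier_linf \<eta>_def \<omega>cl)
    qed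
    then show ?thesis
      by (auto simp: linf.carrier_cochains \<eta>_def PiE_def)
  qed
  have "coboundary G L (linf_act G) n \<eta> = ?c"
  proof (rule linf.cochain_eqI)
    show "coboundary G L (linf_act G) n \<eta> \<in> carrier (cochains G L (Suc n))"
      by (rule linf.coboundary_closed[OF \<eta>])
    show "?c \<in> carrier (cochains G L (Suc n))"
      by (rule const.image_cochain[OF \<omega>C])
    fix gs assume gs: "gs \<in> tuples G (Suc n)"
    then obtain g gs' where gs_eq: "gs = g # gs'" and g: "g \<in> carrier G" and gs': "gs' \<in> tuples G n"
      by (cases gs) (auto simp: tuples_def)
    have "coboundary G L (linf_act G) n \<eta> gs h = ?c gs h" if h: "h \<in> carrier G" for h
    proof -
      let ?k = "inv\<^bsub>G\<^esub> h"
      let ?p = "altprod A (\<lambda>i. \<omega> (?k # face G (Suc i) gs)) n"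
      have k: "?k # gs \<in> tuples G (Suc (Suc n))"
        using gs h by (auto simp: tuples_def)
      have face: "face G (Suc i) gs \<in> tuples G n" if "i \<le> n" for i
        using gs that by (intro G.face_tuples) simp_all
      have p: "?p \<in> carrier A"
        using face h by (auto simp: \<omega>cl)
      \<comment> \<open>The inverse in the definition of \<open>\<eta>\<close> turns the left
        translation by \<open>g\<close> into multiplication of \<open>?k\<close> by \<open>g\<close>
        on the right, which is the merged first entry of \<open>?k # g # gs'\<close>.\<close>
      have "inv\<^bsub>G\<^esub> (inv\<^bsub>G\<^esub> g \<otimes>\<^bsub>G\<^esub> h) = ?k \<otimes>\<^bsub>G\<^esub> g"
        using g h by (simp add: G.inv_mult_group)
      moreover have "altprod A (\<lambda>i. \<eta> (face G (Suc i) gs) h) n = ?p"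
        by (rule altprod_cong) (simp add: \<eta>_def face h)
      moreover have "\<eta> (tl gs) (inv\<^bsub>G\<^esub> (hd gs) \<otimes>\<^bsub>G\<^esub> h) = \<omega> (inv\<^bsub>G\<^esub> (inv\<^bsub>G\<^esub> g \<otimes>\<^bsub>G\<^esub> h) # gs')"
        using g h gs' by (simp add: \<eta>_def gs_eq)
      ultimately have \<delta>\<eta>: "coboundary G L (linf_act G) n \<eta> gs h
          = \<omega> ((?k \<otimes>\<^bsub>G\<^esub> g) # gs') \<otimes>\<^bsub>A\<^esub> inv\<^bsub>A\<^esub> ?p"
        by (simp only: coboundary_linf_apply[OF \<eta> gs h])
      have cl: "\<omega> gs \<in> carrier A" "\<omega> ((?k \<otimes>\<^bsub>G\<^esub> g) # gs') \<in> carrier A"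
        using gs g h gs' by (auto simp: \<omega>cl triv.cochain_closed[OF \<omega>C])
      \<comment> \<open>The faces of \<open>?k # gs\<close> are \<open>gs\<close> itself, then
        \<open>(?k g) # gs'\<close>, and then \<open>?k\<close> followed by the faces of
        \<open>gs\<close> of positive index, whose contribution is \<open>?p\<close>.\<close>
      have "\<one>\<^bsub>A\<^esub> = coboundary G A trivial_act (Suc n) \<omega> (?k # gs)"
        by (simp add: \<omega>0 triv.cochain_one[OF k])
      also have "\<dots> = \<omega> gs \<otimes>\<^bsub>A\<^esub> inv\<^bsub>A\<^esub> (\<omega> ((?k \<otimes>\<^bsub>G\<^esub> g) # gs') \<otimes>\<^bsub>A\<^esub> inv\<^bsub>A\<^esub> ?p)"
        by (subst coboundary_triv_eq_altprod[OF \<omega>C k]) (simp add: gs_eq)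
      finally have "\<omega> gs = \<omega> ((?k \<otimes>\<^bsub>G\<^esub> g) # gs') \<otimes>\<^bsub>A\<^esub> inv\<^bsub>A\<^esub> ?p"
        using cl p by (metis A.inv_closed A.inv_equality A.inv_inv A.m_closed)
      then show ?thesis
        using gs h \<delta>\<eta> by (simp add: const_fun_def)
    qed
    moreover have "coboundary G L (linf_act G) n \<eta> gs \<in> carrier L" "?c gs \<in> carrier L"
      using gs linf.coboundary_closed[OF \<eta>] const.image_cochain[OF \<omega>C]
      by (blast intro: linf.cochain_closed)+
    ultimately show "coboundary G L (linf_act G) n \<eta> gs = ?c gs"
      by (intro linf_eqI)
  qed
  moreover have "coboundary G L (linf_act G) n \<eta> \<in> coboundaries G L (linf_act G) (Suc n)"
    using \<eta> by (simp add: coboundaries_def)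
  ultimately show ?thesis
    by (simp only:)
qed

text \<open>Evaluating a primitive \<open>\<eta>\<close> of \<open>\<omega>\<close> at the identity gives a cochain \<open>\<beta>\<close> with
  \<open>(\<omega> - \<delta>\<beta>)(g\<^sub>1, g\<^sub>2, \<dots>) = \<eta>(g\<^sub>2, \<dots>)(g\<^sub>1\<^sup>-\<^sup>1) - \<eta>(g\<^sub>2, \<dots>)(1)\<close>.\<close>

lemma coboundary_imp_weakly_bounded_representative:
  assumes \<omega>: "\<omega> \<in> cocycles G A trivial_act (Suc n)"
    and cob: "(\<lambda>gs\<in>tuples G (Suc n). const_fun G (\<omega> gs)) \<in> coboundaries G L (linf_act G) (Suc n)"
  shows "weakly_bounded_class bdd G A (Suc n) (cohom_class G A trivial_act (Suc n) \<omega>)"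
proof -
  from cob obtain \<eta> where \<eta>: "\<eta> \<in> carrier (cochains G L n)"
    and \<eta>\<omega>: "(\<lambda>gs\<in>tuples G (Suc n). const_fun G (\<omega> gs)) = coboundary G L (linf_act G) n \<eta>"
    by (auto simp: coboundaries_def)
  have \<omega>C: "\<omega> \<in> carrier (cochains G A (Suc n))"
    using \<omega> by (simp add: cocycles_def kernel_def)
  define \<beta> where "\<beta> = (\<lambda>gs\<in>tuples G n. \<eta> gs \<one>\<^bsub>G\<^esub>)"
  have \<eta>cl: "\<eta> gs h \<in> carrier A" if "gs \<in> tuples G n" "h \<in> carrier G" for gs h
    using linf.cochain_closed[OF \<eta>] that by (intro linf_closed)
  then have \<beta>: "\<beta> \<in> carrier (cochains G A n)"
    by (auto simp: triv.carrier_cochains \<beta>_def)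
  define \<delta>\<beta> where "\<delta>\<beta> = coboundary G A trivial_act n \<beta>"
  have \<delta>\<beta>: "\<delta>\<beta> \<in> coboundaries G A trivial_act (Suc n)"
    using \<beta> by (auto simp: coboundaries_def \<delta>\<beta>_def)
  have \<delta>\<beta>C: "\<delta>\<beta> \<in> carrier (cochains G A (Suc n))"
    unfolding \<delta>\<beta>_def by (rule triv.coboundary_closed[OF \<beta>])
  \<comment> \<open>Additively this is \<open>\<omega> - \<delta>\<beta>\<close>.\<close>
  define \<omega>' where "\<omega>' = inv\<^bsub>cochains G A (Suc n)\<^esub> \<delta>\<beta> \<otimes>\<^bsub>cochains G A (Suc n)\<^esub> \<omega>"
  have "\<omega>' \<in> cohom_class G A trivial_act (Suc n) \<omega>"
    using subgroup.m_inv_closed[OF triv.subgroup_coboundaries \<delta>\<beta>]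
    by (auto simp: cohom_class_def r_coset_def \<omega>'_def)
  then have "cohom_class G A trivial_act (Suc n) \<omega> = cohom_class G A trivial_act (Suc n) \<omega>'"
    using triv.cohom_class_eq[OF \<omega>C] by simp
  moreover have "\<omega>' \<in> cocycles G A trivial_act (Suc n)"
    using \<omega> \<delta>\<beta> coboundaries_triv_subset_cocycles[of n] triv.subgroup_cocycles[of "Suc n"]
    unfolding \<omega>'_def by (blast intro: subgroup.m_closed subgroup.m_inv_closed)
  moreover have "weakly_bounded_cochain bdd G (Suc n) \<omega>'"
    unfolding weakly_bounded_cochain_def
  proof
    fix gs assume "gs \<in> tuples G (Suc n - 1)"
    then have gs: "gs \<in> tuples G n"
      by simp
    have "\<omega>' (g # gs) = inv\<^bsub>A\<^esub> \<eta> gs \<one>\<^bsub>G\<^esub> \<otimes>\<^bsub>A\<^esub> \<eta> gs (inv\<^bsub>G\<^esub> g)" if g: "g \<in> carrier G" for g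
    proof -
      let ?p = "altprod A (\<lambda>i. \<eta> (face G (Suc i) (g # gs)) \<one>\<^bsub>G\<^esub>) n"
      have ggs: "g # gs \<in> tuples G (Suc n)"
        using g gs by (auto simp: tuples_def)
      have face: "face G (Suc i) (g # gs) \<in> tuples G n" if "i \<le> n" for i
        using ggs that by (intro G.face_tuples) simp_all
      have p: "?p \<in> carrier A"
        using face by (auto simp: \<eta>cl)
      \<comment> \<open>The equation \<open>\<omega> = \<delta>\<eta>\<close> is read at h = 1,
        where the translated argument becomes the inverse of \<open>g\<close>.\<close>
      have "\<omega> (g # gs) = (\<lambda>gs\<in>tuples G (Suc n). const_fun G (\<omega> gs)) (g # gs) \<one>\<^bsub>G\<^esub>"
        using ggs by (simp add: const_fun_def)
      also have "\<dots> = \<eta> gs (inv\<^bsub>G\<^esub> g) \<otimes>\<^bsub>A\<^esub> inv\<^bsub>A\<^esub> ?p"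
        unfolding \<eta>\<omega> using g by (simp add: coboundary_linf_apply[OF \<eta> ggs])
      finally have 1: "\<omega> (g # gs) = \<eta> gs (inv\<^bsub>G\<^esub> g) \<otimes>\<^bsub>A\<^esub> inv\<^bsub>A\<^esub> ?p" .
      have "altprod A (\<lambda>i. \<beta> (face G (Suc i) (g # gs))) n = ?p"
        by (rule altprod_cong) (simp add: \<beta>_def face)
      moreover have "\<beta> gs = \<eta> gs \<one>\<^bsub>G\<^esub>"
        using gs by (simp add: \<beta>_def)
      ultimately have 2: "\<delta>\<beta> (g # gs) = \<eta> gs \<one>\<^bsub>G\<^esub> \<otimes>\<^bsub>A\<^esub> inv\<^bsub>A\<^esub> ?p"
        by (simp add: \<delta>\<beta>_def triv.coboundary_altprod[OF \<beta> ggs] trivial_act_def)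
      \<comment> \<open>Both coboundaries contribute the same \<open>?p\<close> from the faces of
        positive index, so it cancels and only the two first terms remain.\<close>
      have "\<omega>' (g # gs) = inv\<^bsub>A\<^esub> (\<eta> gs \<one>\<^bsub>G\<^esub> \<otimes>\<^bsub>A\<^esub> inv\<^bsub>A\<^esub> ?p) \<otimes>\<^bsub>A\<^esub> (\<eta> gs (inv\<^bsub>G\<^esub> g) \<otimes>\<^bsub>A\<^esub> inv\<^bsub>A\<^esub> ?p)"
        by (simp add: \<omega>'_def triv.cochain_mult[OF ggs] triv.cochain_inv[OF \<delta>\<beta>C ggs] 1 2)
      also have "\<dots> = (inv\<^bsub>A\<^esub> \<eta> gs \<one>\<^bsub>G\<^esub> \<otimes>\<^bsub>A\<^esub> \<eta> gs (inv\<^bsub>G\<^esub> g)) \<otimes>\<^bsub>A\<^esub> (?p \<otimes>\<^bsub>A\<^esub> inv\<^bsub>A\<^esub> ?p)"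
        using p gs g by (simp add: \<eta>cl A.inv_mult A.m_ac del: A.r_inv A.Units_r_inv)
      finally show ?thesis
        using p gs g by (simp add: \<eta>cl)
    qed
    \<comment> \<open>For fixed \<open>gs\<close>, all values are one constant times a value of the
      single bounded function \<open>\<eta> gs\<close>.\<close>
    then have "{\<omega>' (g # gs) | g. g \<in> carrier G} \<subseteq> {inv\<^bsub>A\<^esub> \<eta> gs \<one>\<^bsub>G\<^esub>} <#>\<^bsub>A\<^esub> \<eta> gs ` carrier G"
      by (fastforce simp: set_mult_def)
    moreover have "bdd ({inv\<^bsub>A\<^esub> \<eta> gs \<one>\<^bsub>G\<^esub>} <#>\<^bsub>A\<^esub> \<eta> gs ` carrier G)"
      using linf.cochain_closed[OF \<eta> gs]
      by (intro bdd_mult bdd_singleton) (auto simp: carrier_linf \<eta>cl gs)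
    ultimately show "bdd {\<omega>' (g # gs) | g. g \<in> carrier G}"
      by (rule bdd_subset[rotated])
  qed
  ultimately show ?thesis
    unfolding weakly_bounded_class_def by blast
qed

text \<open>The neutral element of the quotient is the coset of coboundaries, so vanishing of the
  image can be tested on any representative: the weakly bounded one in one direction, an arbitrary
  one in the other.\<close>

lemma weakly_bounded_class_iff_iota:
  assumes \<alpha>: "\<alpha> \<in> carrier (cohomology G A trivial_act (Suc n))"
  shows "weakly_bounded_class bdd G A (Suc n) \<alpha>
    \<longleftrightarrow> iota bdd G A (Suc n) \<alpha> = \<one>\<^bsub>linf_cohomology bdd G A (Suc n)\<^esub>"
proof -
  have iota: "iota bdd G A (Suc n) (cohom_class G A trivial_act (Suc n) \<omega>)
      = \<one>\<^bsub>linf_cohomology bdd G A (Suc n)\<^esub>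
    \<longleftrightarrow> (\<lambda>gs\<in>tuples G (Suc n). const_fun G (\<omega> gs)) \<in> coboundaries G L (linf_act G) (Suc n)"
    if "\<omega> \<in> cocycles G A trivial_act (Suc n)" for \<omega>
  proof -
    have \<omega>: "\<omega> \<in> carrier (cochains G A (Suc n))"
      using that by (simp add: cocycles_def kernel_def)
    have "iota bdd G A (Suc n) (cohom_class G A trivial_act (Suc n) \<omega>)
        = cohom_class G L (linf_act G) (Suc n) (\<lambda>gs\<in>tuples G (Suc n). const_fun G (\<omega> gs))"
      unfolding iota_def by (rule const.coeff_map_cohom_class[OF \<omega>])
    moreover have "\<one>\<^bsub>linf_cohomology bdd G A (Suc n)\<^esub> = coboundaries G L (linf_act G) (Suc n)"
      by (simp add: linf_cohomology_def cohomology_def FactGroup_def)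
    ultimately show ?thesis
      using linf.cohom_class_self[OF const.image_cochain[OF \<omega>]] linf.cohom_class_coboundary
      by metis
  qed
  obtain \<omega> where "\<omega> \<in> cocycles G A trivial_act (Suc n)"
    and "\<alpha> = cohom_class G A trivial_act (Suc n) \<omega>"
    using \<alpha> by (auto simp: cohomology_def FactGroup_def RCOSETS_def r_coset_def cohom_class_def)
  then show ?thesis
    using iota coboundary_imp_weakly_bounded_representative weakly_bounded_cocycle_imp_coboundary
    unfolding weakly_bounded_class_def by metis
qed

end

section \<open>The two notions of boundedness: finite sets and bounded sets of reals\<close>

lemma comm_group_real_group: "comm_group real_group"
proof (rule comm_groupI)
  show "\<exists>y\<in>carrier real_group. y \<otimes>\<^bsub>real_group\<^esub> x = \<one>\<^bsub>real_group\<^esub>" for x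
    by (intro bexI[of _ "- x"]) (auto simp: real_group_def)
qed (auto simp: real_group_def)

lemma real_group_inv: "inv\<^bsub>real_group\<^esub> x = - x"
proof -
  interpret comm_group real_group
    by (rule comm_group_real_group)
  show ?thesis
    by (rule inv_equality) (auto simp: real_group_def)
qed

lemma bounded_coefficients_finite:
  assumes "group G" "comm_group A"
  shows "bounded_coefficients G A finite"
proof -
  interpret G: group G by fact
  interpret A: comm_group A by fact
  show ?thesis
    by unfold_locales (auto simp: set_mult_def intro: finite_subset)
qed

lemma bounded_coefficients_real:
  assumes "group G"
  shows "bounded_coefficients G real_group bounded"
proof -
  interpret G: group G by fact
  interpret A: comm_group real_group by (rule comm_group_real_group)
  show ?thesis
  proof unfold_locales
    fix S T :: "real set"
    assume "bounded S" "bounded T"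
    then have "bounded (\<Union>x\<in>S. \<Union>y\<in>T. {x + y})"
      by (rule bounded_sums)
    then show "bounded (S <#>\<^bsub>real_group\<^esub> T)"
      by (rule bounded_subset) (auto simp: set_mult_def real_group_def)
  next
    fix S :: "real set"
    assume "bounded S"
    moreover have "m_inv real_group ` S = uminus ` S"
      by (simp add: real_group_inv)
    ultimately show "bounded (m_inv real_group ` S)"
      by (simp only: bounded_uminus)
  qed (auto intro: bounded_subset)
qed

theorem proposition11:
  fixes G :: "('g, 'x) monoid_scheme" and A :: "('a, 'y) monoid_scheme" and n :: nat
  assumes "group G" and "n \<ge> 1"
  shows "(comm_group A \<and> finitely_generated_group A \<longrightarrow>
            (\<forall>\<alpha>\<in>carrier (cohomology G A trivial_act n).
               weakly_bounded_class finite G A n \<alpha> \<longleftrightarrow>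
               iota finite G A n \<alpha> = \<one>\<^bsub>linf_cohomology finite G A n\<^esub>)) \<and>
         (\<forall>\<alpha>\<in>carrier (cohomology G real_group trivial_act n).
            weakly_bounded_class bounded G real_group n \<alpha> \<longleftrightarrow>
            iota bounded G real_group n \<alpha> = \<one>\<^bsub>linf_cohomology bounded G real_group n\<^esub>)"
proof -
  obtain k where n: "n = Suc k"
    using \<open>n \<ge> 1\<close> by (cases n) auto
  show ?thesis
    unfolding n
    using bounded_coefficients.weakly_bounded_class_iff_iota[OF bounded_coefficients_finite]
      bounded_coefficients.weakly_bounded_class_iff_iota[OF bounded_coefficients_real] \<open>group G\<close>
    by blast
qed

end
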